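(* Let $X$ be a real Hilbert space and let $T\colon X\to X$ be nonexpansive. Suppose that $T$ is affine, say $T\colon x\mapsto Lx+b$, where $L\colon X\to X$ is linear and nonexpansive and $b\in X$. Suppose furthermore that $L$ is asymptotically regular, and let $x$ and $y$ be points in $X$. Then $T^n x-T^n y=L^n(x-y)$ for every $n\in\mathbb{N}$, and $$L^n(x-y)\to P_{\operatorname{Fix}(L)}(x-y)$$ strongly (in norm) as $n\to\infty$.
   Context: A map $S\colon X\to X$ is nonexpansive if $\|Sx-Sy\|\le\|x-y\|$ for all $x,y\in X$; it is asymptotically regular if $S^nx-S^{n+1}x\to 0$ (in norm) for every $x\in X$. $\operatorname{Fix}(L)=\{x\in X : Lx=x\}$, a closed linear subspace, and $P_{\operatorname{Fix}(L)}$ is the orthogonal projector onto it. *)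

theory Defs
  imports "HOL-Analysis.Analysis"
begin

definition nonexpansive :: "('a::real_normed_vector \<Rightarrow> 'a) \<Rightarrow> bool" where
  "nonexpansive S \<longleftrightarrow> (\<forall>x y. norm (S x - S y) \<le> norm (x - y))"

definition asymptotically_regular :: "('a::real_normed_vector \<Rightarrow> 'a) \<Rightarrow> bool" where
  "asymptotically_regular S \<longleftrightarrow> (\<forall>x. (\<lambda>n. (S ^^ n) x - (S ^^ Suc n) x) \<longlonglongrightarrow> 0)"

definition Fix :: "('a \<Rightarrow> 'a) \<Rightarrow> 'a set" where
  "Fix S = {x. S x = x}"

text \<open>
  The library's \<open>closest_point\<close> is restricted to types of class \<open>heine_borel\<close> and hence does not
  cover infinite-dimensional Hilbert spaces. The description below is meaningful when \<open>M\<close> is a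
  closed subspace of a Hilbert space: the projection theorem gives existence and uniqueness
  of \<open>p\<close>.
\<close>

definition orthogonal_projector :: "'a::{real_inner, complete_space} set \<Rightarrow> 'a \<Rightarrow> 'a" where
  "orthogonal_projector M x = (THE p. p \<in> M \<and> x - p \<in> M\<^sup>\<bottom>)"

end

theory Submission
  imports Defs
begin

text \<open>
  Let \<open>N\<close> be the set of all \<open>u\<close> with \<open>L\<^sup>n u \<longlonglongrightarrow> 0\<close>. It is a closed subspace since the powers of
  \<open>L\<close> are nonexpansive, and it contains every \<open>u - L u\<close> by asymptotic regularity. Nonexpansiveness
  makes \<open>Fix L\<close> orthogonal to all \<open>u - L u\<close>, so \<open>\<langle>f, u\<rangle> = \<langle>f, L\<^sup>n u\<rangle>\<close> for \<open>f\<close> in \<open>Fix L\<close>, whence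
  \<open>Fix L\<close> is orthogonal to \<open>N\<close>. Conversely, if \<open>p\<close> is orthogonal to \<open>N\<close>, then it is orthogonal to
  \<open>p - L p\<close>, and nonexpansiveness forces \<open>L p = p\<close>. Projecting \<open>x\<close> onto \<open>N\<close> thus gives
  \<open>x = p + q\<close> with \<open>p\<close> in \<open>Fix L\<close> and \<open>q\<close> in \<open>N\<close>, and \<open>L\<^sup>n x = p + L\<^sup>n q\<close> tends to \<open>p\<close>.
\<close>

section \<open>Orthogonal decomposition along a closed subspace of a Hilbert space\<close>

lemma parallelogram_law:
  fixes u v :: "'a::real_inner"
  shows "(norm (u + v))\<^sup>2 + (norm (u - v))\<^sup>2 = 2 * (norm u)\<^sup>2 + 2 * (norm v)\<^sup>2"
  by (simp add: power2_norm_eq_inner inner_simps)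

lemma power2_norm_add_scaleR:
  fixes u v :: "'a::real_inner"
  shows "(norm (u + t *\<^sub>R v))\<^sup>2 = (norm u)\<^sup>2 + 2 * t * (u \<bullet> v) + t\<^sup>2 * (norm v)\<^sup>2"
  unfolding power2_norm_eq_inner inner_add inner_scaleR_left inner_scaleR_right
  by (simp only: inner_commute[of v u] power2_eq_square) (simp add: algebra_simps)

text \<open>Near \<open>t = 0\<close> the linear term dominates, so a nonzero \<open>a\<close> would
  give a negative value. This is the first-order condition behind both variational arguments
  below.\<close>

lemma linear_coeff_eq_0_if_quadratic_nonneg:
  fixes a c :: real
  assumes "\<And>t. 0 \<le> 2 * t * a + t\<^sup>2 * c"
  shows "a = 0"
proof -
  \<comment> \<open>At \<open>t = - a / k\<close> the quadratic equals
    \<open>(a / k)\<^sup>2 * (c - 2 * k)\<close>; this \<open>k\<close> makes the last factor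
    negative, and the \<open>1\<close> keeps \<open>k\<close> positive if
    \<open>c = 0\<close>.\<close>
  define k where "k = \<bar>c\<bar> + 1"
  have k: "k > 0" "c - 2 * k < 0"
    by (auto simp: k_def)
  have "2 * (- a / k) * a + (- a / k)\<^sup>2 * c = (a / k)\<^sup>2 * (c - 2 * k)"
    using k by (simp add: field_simps power2_eq_square)
  then have "0 \<le> (a / k)\<^sup>2 * (c - 2 * k)"
    using assms[of "- a / k"] by simp
  with k have "(a / k)\<^sup>2 \<le> 0"
    by (simp add: zero_le_mult_iff)
  with k show ?thesis
    by simp
qed

text \<open>By the parallelogram law a minimizing sequence is Cauchy; its limit stays in
  \<open>M\<close> and attains the infimum.\<close>

lemma subspace_nearest_point_exists:
  fixes M :: "'a::{real_inner, complete_space} set"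
  assumes M: "subspace M" "closed M"
  obtains q where "q \<in> M" "\<And>r. r \<in> M \<Longrightarrow> norm (x - q) \<le> norm (x - r)"
proof -
  define d where "d = Inf ((\<lambda>r. (norm (x - r))\<^sup>2) ` M)"
  have bdd: "bdd_below ((\<lambda>r. (norm (x - r))\<^sup>2) ` M)"
    by (rule bdd_belowI[of _ 0]) auto
  have d_le: "d \<le> (norm (x - r))\<^sup>2" if "r \<in> M" for r
    unfolding d_def using bdd that by (rule cINF_lower)
  have "\<exists>r\<in>M. (norm (x - r))\<^sup>2 < d + inverse (real (Suc n))" for n
    using cInf_lessD[of "(\<lambda>r. (norm (x - r))\<^sup>2) ` M" "d + inverse (real (Suc n))"]
      subspace_0[OF M(1)] by (auto simp: d_def)
  then obtain r where r: "\<And>n. r n \<in> M"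
      "\<And>n. (norm (x - r n))\<^sup>2 < d + inverse (real (Suc n))"
    by metis
  have dist_r: "(norm (r m - r n))\<^sup>2 \<le> 2 * inverse (real (Suc m)) + 2 * inverse (real (Suc n))"
    for m n
  proof -
    \<comment> \<open>The midpoint is again a competitor, which bounds the sum term of the
      parallelogram law below by \<open>4 * d\<close>; only the excesses over \<open>d\<close>
      remain.\<close>
    have "(1/2) *\<^sub>R (r m + r n) \<in> M"
      using M(1) r(1) by (simp add: subspace_add subspace_scale)
    from d_le[OF this] have "4 * d \<le> (norm (2 *\<^sub>R (x - (1/2) *\<^sub>R (r m + r n))))\<^sup>2"
      by (simp only: norm_scaleR power_mult_distrib) simp
    also have "2 *\<^sub>R (x - (1/2) *\<^sub>R (r m + r n)) = (x - r m) + (x - r n)"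
      by (simp add: algebra_simps scaleR_2)
    finally have "4 * d \<le> (norm ((x - r m) + (x - r n)))\<^sup>2" .
    moreover have "norm ((x - r m) - (x - r n)) = norm (r m - r n)"
      by (simp add: norm_minus_commute)
    ultimately show ?thesis
      using parallelogram_law[of "x - r m" "x - r n"] r(2)[of m] r(2)[of n] by simp
  qed
  have "Cauchy r"
  proof (rule metric_CauchyI)
    fix e :: real
    assume "e > 0"
    then obtain K where K: "inverse (real (Suc K)) < e\<^sup>2 / 4"
      using reals_Archimedean[of "e\<^sup>2 / 4"] by auto
    have "dist (r m) (r n) < e" if "m \<ge> K" "n \<ge> K" for m n
    proof -
      have "inverse (real (Suc m)) \<le> inverse (real (Suc K))"
        "inverse (real (Suc n)) \<le> inverse (real (Suc K))"
        using that by (auto intro: le_imp_inverse_le)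
      then have "(norm (r m - r n))\<^sup>2 < e\<^sup>2"
        using dist_r[of m n] K by linarith
      then show ?thesis
        using \<open>e > 0\<close> by (simp add: dist_norm power_less_imp_less_base)
    qed
    then show "\<exists>K. \<forall>m\<ge>K. \<forall>n\<ge>K. dist (r m) (r n) < e"
      by blast
  qed
  then obtain q where q: "r \<longlonglongrightarrow> q"
    using Cauchy_convergent convergentD by blast
  have "q \<in> M"
    using M(2) r(1) q closed_sequentially by blast
  have "(norm (x - q))\<^sup>2 \<le> d + 0"
  proof (rule LIMSEQ_le)
    show "(\<lambda>n. (norm (x - r n))\<^sup>2) \<longlonglongrightarrow> (norm (x - q))\<^sup>2"
      by (intro tendsto_intros q)
    show "(\<lambda>n. d + inverse (real (Suc n))) \<longlonglongrightarrow> d + 0"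
      by (intro tendsto_intros LIMSEQ_inverse_real_of_nat)
    show "\<exists>N. \<forall>n\<ge>N. (norm (x - r n))\<^sup>2 \<le> d + inverse (real (Suc n))"
      using r(2) less_imp_le by blast
  qed
  then have "norm (x - q) \<le> norm (x - s)" if "s \<in> M" for s
    using power2_le_imp_le[OF order_trans[OF _ d_le[OF that]]] by simp
  with \<open>q \<in> M\<close> show thesis
    by (rule that)
qed

text \<open>Moving the nearest point \<open>q\<close> along any \<open>r\<close> in \<open>M\<close>
  cannot decrease the distance to \<open>x\<close>, so the first-order term
  \<open>r \<bullet> (x - q)\<close> vanishes.\<close>

theorem closed_subspace_orthogonal_decomposition:
  fixes M :: "'a::{real_inner, complete_space} set"
  assumes M: "subspace M" "closed M"
  obtains q where "q \<in> M" "x - q \<in> M\<^sup>\<bottom>"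
proof -
  obtain q where q: "q \<in> M" "\<And>r. r \<in> M \<Longrightarrow> norm (x - q) \<le> norm (x - r)"
    using subspace_nearest_point_exists[OF M] by blast
  have "r \<bullet> (x - q) = 0" if "r \<in> M" for r
  proof (rule linear_coeff_eq_0_if_quadratic_nonneg)
    fix t :: real
    have "q - t *\<^sub>R r \<in> M"
      using M(1) q(1) that by (simp add: subspace_diff subspace_scale)
    then have "(norm (x - q))\<^sup>2 \<le> (norm ((x - q) + t *\<^sub>R r))\<^sup>2"
      using q(2)[of "q - t *\<^sub>R r"] by (simp add: algebra_simps power_mono)
    also have "\<dots> = (norm (x - q))\<^sup>2 + 2 * t * (r \<bullet> (x - q)) + t\<^sup>2 * (norm r)\<^sup>2"
      by (simp add: power2_norm_add_scaleR inner_commute)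
    finally show "0 \<le> 2 * t * (r \<bullet> (x - q)) + t\<^sup>2 * (norm r)\<^sup>2"
      by simp
  qed
  with q(1) show thesis
    by (intro that) (auto simp: orthogonal_comp_def orthogonal_def)
qed

text \<open>Two candidates differ by a vector of \<open>M\<close> that is orthogonal to both
  residuals, hence to itself.\<close>

lemma orthogonal_projector_eqI:
  assumes "subspace M" "p \<in> M" "x - p \<in> M\<^sup>\<bottom>"
  shows "orthogonal_projector M x = p"
  unfolding orthogonal_projector_def
proof (rule the_equality)
  fix p'
  assume p': "p' \<in> M \<and> x - p' \<in> M\<^sup>\<bottom>"
  with assms have "p' - p \<in> M"
    by (simp add: subspace_diff)
  with assms(3) p' have "(p' - p) \<bullet> (x - p) = 0" "(p' - p) \<bullet> (x - p') = 0"
    by (auto simp: orthogonal_comp_def orthogonal_def)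
  then have "(p' - p) \<bullet> (p' - p) = 0"
    by (simp add: inner_diff_right)
  then show "p' = p"
    by simp
qed (use assms in auto)

section \<open>Iterates and fixed points of linear nonexpansive maps\<close>

lemma linear_funpow:
  fixes L :: "'a::real_vector \<Rightarrow> 'a"
  assumes "linear L"
  shows "linear (L ^^ n)"
proof (induction n)
  case (Suc n)
  then show ?case
    using linear_compose[OF Suc assms] by (simp add: o_def)
qed (simp add: linear_id[unfolded id_def])

lemma linear_nonexpansive_norm_le:
  assumes "linear L" "nonexpansive L"
  shows "norm (L u) \<le> norm u"
  using assms(2)[unfolded nonexpansive_def, rule_format, of u 0] linear_0[OF assms(1)] by simp

lemma nonexpansive_funpow:
  assumes "nonexpansive S"
  shows "nonexpansive (S ^^ n)"
proof (induction n)
  case (Suc n)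
  show ?case
    unfolding nonexpansive_def
  proof (intro allI)
    fix x y
    have "norm ((S ^^ Suc n) x - (S ^^ Suc n) y) \<le> norm ((S ^^ n) x - (S ^^ n) y)"
      using assms by (simp add: nonexpansive_def)
    also have "\<dots> \<le> norm (x - y)"
      using Suc by (simp add: nonexpansive_def)
    finally show "norm ((S ^^ Suc n) x - (S ^^ Suc n) y) \<le> norm (x - y)" .
  qed
qed (simp add: nonexpansive_def)

lemma subspace_Fix: "linear L \<Longrightarrow> subspace (Fix L)"
  by (simp add: subspace_def Fix_def linear_0 linear_add linear_scale)

lemma funpow_Fix: "f \<in> Fix S \<Longrightarrow> (S ^^ n) f = f"
  by (induction n) (simp_all add: Fix_def)

text \<open>In effect \<open>f\<close> is also fixed by the adjoint of \<open>L\<close>. The reason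
  is first-order: \<open>L\<close> sends \<open>f + t *\<^sub>R u\<close> to
  \<open>f + t *\<^sub>R L u\<close> without increasing the norm, for every
  \<open>t\<close>.\<close>

lemma inner_Fix_invariant:
  fixes L :: "'a::real_inner \<Rightarrow> 'a"
  assumes L: "linear L" "nonexpansive L" and f: "f \<in> Fix L"
  shows "f \<bullet> L u = f \<bullet> u"
proof -
  have "f \<bullet> u - f \<bullet> L u = 0"
  proof (rule linear_coeff_eq_0_if_quadratic_nonneg)
    fix t :: real
    have "L (f + t *\<^sub>R u) = f + t *\<^sub>R L u"
      using f by (simp add: L(1) linear_add linear_scale Fix_def)
    then have "(norm (f + t *\<^sub>R L u))\<^sup>2 \<le> (norm (f + t *\<^sub>R u))\<^sup>2"
      using linear_nonexpansive_norm_le[OF L, of "f + t *\<^sub>R u"] by (simp add: power_mono)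
    then show "0 \<le> 2 * t * (f \<bullet> u - f \<bullet> L u) + t\<^sup>2 * ((norm u)\<^sup>2 - (norm (L u))\<^sup>2)"
      by (simp add: power2_norm_add_scaleR algebra_simps)
  qed
  then show ?thesis
    by simp
qed

lemma inner_Fix_funpow:
  fixes L :: "'a::real_inner \<Rightarrow> 'a"
  assumes "linear L" "nonexpansive L" "f \<in> Fix L"
  shows "f \<bullet> (L ^^ n) u = f \<bullet> u"
  by (induction n) (simp_all add: inner_Fix_invariant[OF assms])

lemma mem_Fix_if_orthogonal_displacement:
  fixes L :: "'a::real_inner \<Rightarrow> 'a"
  assumes L: "linear L" "nonexpansive L" and p: "(p - L p) \<bullet> p = 0"
  shows "p \<in> Fix L"
proof -
  have "(norm (p - L p))\<^sup>2 = (norm (L p))\<^sup>2 - (norm p)\<^sup>2 + 2 * ((p - L p) \<bullet> p)"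
    by (simp add: power2_norm_eq_inner inner_simps inner_commute)
  also have "\<dots> \<le> 0"
    using linear_nonexpansive_norm_le[OF L, of p] p by (simp add: power_mono)
  finally show ?thesis
    by (simp add: Fix_def)
qed

section \<open>The subspace of vectors whose orbits vanish in the limit\<close>

definition null_orbits :: "('a::real_normed_vector \<Rightarrow> 'a) \<Rightarrow> 'a set" where
  "null_orbits L = {u. (\<lambda>n. (L ^^ n) u) \<longlonglongrightarrow> 0}"

lemma subspace_null_orbits:
  assumes "linear L"
  shows "subspace (null_orbits L)"
proof -
  note lin = linear_funpow[OF assms]
  show ?thesis
    unfolding subspace_def null_orbits_def
    by (auto simp: linear_0[OF lin] linear_add[OF lin] linear_scale[OF lin]
        intro: tendsto_add_zero tendsto_scaleR[OF tendsto_const, where b = 0, simplified])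
qed

text \<open>All iterates are 1-Lipschitz, so replacing \<open>u\<close> by a nearby \<open>v\<close>
  costs less than \<open>e / 2\<close> uniformly in \<open>n\<close>.\<close>

lemma closed_null_orbits:
  assumes L: "nonexpansive L"
  shows "closed (null_orbits L)"
proof -
  have "u \<in> null_orbits L" if u: "u \<in> closure (null_orbits L)" for u
  proof -
    have "\<exists>N. \<forall>n\<ge>N. norm ((L ^^ n) u - 0) < e" if "e > 0" for e
    proof -
      obtain v where v: "v \<in> null_orbits L" "dist v u < e / 2"
        using u \<open>e > 0\<close> by (metis closure_approachable half_gt_zero)
      obtain N where N: "\<And>n. n \<ge> N \<Longrightarrow> norm ((L ^^ n) v) < e / 2"
        using v(1) LIMSEQ_D[of "\<lambda>n. (L ^^ n) v" 0 "e / 2"] \<open>e > 0\<close>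
        by (auto simp: null_orbits_def)
      have "norm ((L ^^ n) u) < e" if "n \<ge> N" for n
      proof -
        have "norm ((L ^^ n) u - (L ^^ n) v) \<le> norm (u - v)"
          using nonexpansive_funpow[OF L, of n] by (simp add: nonexpansive_def)
        also have "\<dots> < e / 2"
          using v(2) by (simp add: dist_norm norm_minus_commute)
        finally show ?thesis
          using N[OF that] norm_triangle_sub[of "(L ^^ n) u" "(L ^^ n) v"] by linarith
      qed
      then show ?thesis
        by auto
    qed
    then show ?thesis
      unfolding null_orbits_def by (intro CollectI LIMSEQ_I)
  qed
  then show ?thesis
    by (simp add: subsetI flip: closure_subset_eq)
qed

lemma displacement_in_null_orbits:
  assumes "linear L" "asymptotically_regular L"
  shows "u - L u \<in> null_orbits L"
  using assms(2)
  by (simp add: null_orbits_def asymptotically_regular_def linear_diff[OF linear_funpow[OF assms(1)]]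
      funpow_swap1)

lemma Fix_orthogonal_null_orbits:
  fixes L :: "'a::real_inner \<Rightarrow> 'a"
  assumes L: "linear L" "nonexpansive L" and "f \<in> Fix L" "u \<in> null_orbits L"
  shows "f \<bullet> u = 0"
proof -
  have "(\<lambda>n. f \<bullet> (L ^^ n) u) \<longlonglongrightarrow> f \<bullet> 0"
    using assms(4) unfolding null_orbits_def by (intro tendsto_intros) simp
  then have "(\<lambda>n::nat. f \<bullet> u) \<longlonglongrightarrow> 0"
    by (simp add: inner_Fix_funpow[OF L assms(3)])
  then show ?thesis
    by (simp add: LIMSEQ_const_iff)
qed

theorem linear_nonexpansive_funpow_tendsto_projector:
  fixes L :: "'a::{real_inner, complete_space} \<Rightarrow> 'a"
  assumes L: "linear L" "nonexpansive L" and "asymptotically_regular L"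
  shows "(\<lambda>n. (L ^^ n) z) \<longlonglongrightarrow> orthogonal_projector (Fix L) z"
proof -
  \<comment> \<open>Splitting along \<open>null_orbits L\<close> instead of \<open>Fix L\<close>
    makes the orbit of \<open>q\<close> vanish by construction; it remains to see that the other
    summand is fixed.\<close>
  obtain q where q: "q \<in> null_orbits L" "z - q \<in> (null_orbits L)\<^sup>\<bottom>"
    using closed_subspace_orthogonal_decomposition[OF subspace_null_orbits[OF L(1)]
        closed_null_orbits[OF L(2)]] by blast
  define p where "p = z - q"
  have "p \<in> Fix L"
    using q(2) displacement_in_null_orbits[OF L(1) assms(3), of p]
    by (intro mem_Fix_if_orthogonal_displacement[OF L])
      (simp add: p_def orthogonal_comp_def orthogonal_def)
  moreover have "z - p \<in> (Fix L)\<^sup>\<bottom>"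
    using q(1) Fix_orthogonal_null_orbits[OF L]
    by (auto simp: p_def orthogonal_comp_def orthogonal_def)
  ultimately have "orthogonal_projector (Fix L) z = p"
    by (intro orthogonal_projector_eqI subspace_Fix L)
  moreover have "(L ^^ n) z = p + (L ^^ n) q" for n
    using linear_add[OF linear_funpow[OF L(1)], of n p q] funpow_Fix[OF \<open>p \<in> Fix L\<close>, of n]
    by (simp add: p_def)
  moreover have "(\<lambda>n. p + (L ^^ n) q) \<longlonglongrightarrow> p + 0"
    using q(1) unfolding null_orbits_def by (intro tendsto_intros) simp
  ultimately show ?thesis
    by simp
qed

text \<open>The translation \<open>b\<close> cancels in each difference, so one step of
  \<open>T\<close> acts on differences as \<open>L\<close>.\<close>

lemma affine_funpow_diff:
  fixes T L :: "'a::real_vector \<Rightarrow> 'a"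
  assumes "\<And>z. T z = L z + b" "linear L"
  shows "(T ^^ n) x - (T ^^ n) y = (L ^^ n) (x - y)"
  by (induction n) (simp_all add: assms(1) linear_diff[OF assms(2), symmetric])

theorem theorem3p8:
  fixes T L :: "'a::{real_inner, complete_space} \<Rightarrow> 'a" and b x y :: 'a
  assumes "nonexpansive T"
    and "\<And>z. T z = L z + b"
    and "linear L"
    and "nonexpansive L"
    and "asymptotically_regular L"
  shows "(\<forall>n. (T ^^ n) x - (T ^^ n) y = (L ^^ n) (x - y)) \<and>
         (\<lambda>n. (L ^^ n) (x - y)) \<longlonglongrightarrow> orthogonal_projector (Fix L) (x - y)"
  using affine_funpow_diff[OF assms(2,3)]
    linear_nonexpansive_funpow_tendsto_projector[OF assms(3-5)]
  by blast

end
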